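(* For each fixed integer $n\ge 1$, $a_n^I(FS_r)$ is a polynomial in $r$ of degree $n$ with no constant term; that is, there is a polynomial $Q_n$ of degree exactly $n$ with $Q_n(0)=0$ such that $a_n^I(FS_r)=Q_n(r)$ for all integers $r\ge 1$.
   Context: $FS_r$ is the free semigroup of rank $r$, i.e. all non-empty words over an alphabet of $r$ letters under concatenation. The (Rees) index of a subset $T\subseteq S$ is $|S\setminus T|$. A (two-sided) ideal $I$ of a semigroup $S$ is a subsemigroup with $SI\subseteq I$ and $IS\subseteq I$. $a_n^I(FS_r)$ denotes the number of two-sided ideals of $FS_r$ of Rees index exactly $n$. *)

theory Defs
  imports Complex_Main "HOL-Computational_Algebra.Polynomial"
begin

definition subsemigroup_of :: "'a set \<Rightarrow> ('a \<Rightarrow> 'a \<Rightarrow> 'a) \<Rightarrow> 'a set \<Rightarrow> bool" where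
  "subsemigroup_of S f T \<longleftrightarrow> T \<subseteq> S \<and> (\<forall>x\<in>T. \<forall>y\<in>T. f x y \<in> T)"

text \<open>The empty set is admitted as a subsemigroup and as an ideal. This does not affect
  the count below: an ideal of finite Rees index in an infinite semigroup is non-empty.\<close>

definition two_sided_ideal :: "'a set \<Rightarrow> ('a \<Rightarrow> 'a \<Rightarrow> 'a) \<Rightarrow> 'a set \<Rightarrow> bool" where
  "two_sided_ideal S f I \<longleftrightarrow>
     subsemigroup_of S f I \<and> (\<forall>s\<in>S. \<forall>x\<in>I. f s x \<in> I) \<and> (\<forall>s\<in>S. \<forall>x\<in>I. f x s \<in> I)"

text \<open>Finiteness is required explicitly because \<^const>\<open>card\<close> is \<open>0\<close> on infinite sets.\<close>

definition has_rees_index :: "'a set \<Rightarrow> 'a set \<Rightarrow> nat \<Rightarrow> bool" where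
  "has_rees_index S T n \<longleftrightarrow> T \<subseteq> S \<and> finite (S - T) \<and> card (S - T) = n"

definition ideals_of_index :: "'a set \<Rightarrow> ('a \<Rightarrow> 'a \<Rightarrow> 'a) \<Rightarrow> nat \<Rightarrow> 'a set set" where
  "ideals_of_index S f n = {I. two_sided_ideal S f I \<and> has_rees_index S I n}"

text \<open>The carrier of the free semigroup on the \<open>r\<close> letters \<open>0, \<dots>, r - 1\<close>;
  its operation is concatenation \<^term>\<open>(@)\<close>.\<close>

definition free_semigroup :: "nat \<Rightarrow> nat list set" where
  "free_semigroup r = {w. w \<noteq> [] \<and> set w \<subseteq> {..<r}}"

definition num_ideals_FS :: "nat \<Rightarrow> nat \<Rightarrow> nat" where
  "num_ideals_FS n r = card (ideals_of_index (free_semigroup r) (@) n)"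

end

theory Submission
  imports Defs
begin

text \<open>The complement of an ideal of a free semigroup is a set of words closed under taking non-empty
  factors. Such a set of size \<open>n\<close> contains, as one-letter words, all letters occurring in it, so it
  uses at most \<open>n\<close> letters; and the number \<open>c k\<close> of such sets using exactly a given set of \<open>k\<close> letters
  depends only on \<open>k\<close>. Hence the count is \<open>\<Sum>k\<le>n. c k * (r choose k)\<close>, where \<open>c 0 = 0\<close> since
  \<open>n \<ge> 1\<close>, and \<open>c n = 1\<close> because \<open>n\<close> one-letter words leave room for nothing else.\<close>

section \<open>Factor-closed sets of words and their size bounds\<close>

definition factor_closed :: "'a list set \<Rightarrow> bool" where
  "factor_closed C \<longleftrightarrow> [] \<notin> C \<and> (\<forall>u v w. u @ v @ w \<in> C \<longrightarrow> v \<noteq> [] \<longrightarrow> v \<in> C)"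

definition letters :: "'a list set \<Rightarrow> 'a set" where
  "letters C = (\<Union>w\<in>C. set w)"

text \<open>Prescribing the letter set exactly, rather than as an upper bound, makes the families
  for different \<open>A\<close> disjoint, so their cardinalities can be added.\<close>

definition closed_sets :: "nat \<Rightarrow> 'a set \<Rightarrow> 'a list set set" where
  "closed_sets n A = {C. factor_closed C \<and> finite C \<and> card C = n \<and> letters C = A}"

lemma factor_closed_letter:
  assumes "factor_closed C" "a \<in> letters C"
  shows "[a] \<in> C"
proof -
  obtain w where "w \<in> C" "a \<in> set w" using assms(2) by (auto simp: letters_def)
  then obtain u v where "u @ [a] @ v \<in> C" by (auto simp: in_set_conv_decomp)
  then show ?thesis using assms(1) by (force simp: factor_closed_def)
qed

lemma factor_closed_singletons_subset:
  "factor_closed C \<Longrightarrow> (\<lambda>a. [a]) ` letters C \<subseteq> C"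
  using factor_closed_letter by auto

lemma card_letter_words: "card ((\<lambda>a. [a]) ` A) = card A"
  by (rule card_image) (auto simp: inj_on_def)

lemma card_letters_le:
  assumes "factor_closed C" "finite C"
  shows "card (letters C) \<le> card C"
  using card_mono[OF assms(2) factor_closed_singletons_subset[OF assms(1)]]
  by (simp add: card_letter_words)

text \<open>The non-empty prefixes of \<open>w\<close> are factors of pairwise different lengths, so
  \<open>C\<close> has at least \<open>length w\<close> members. The bound leaves only finitely many
  candidate words over a finite alphabet.\<close>

lemma length_le_card:
  assumes "factor_closed C" "finite C" "w \<in> C"
  shows "length w \<le> card C"
proof -
  have "(\<lambda>i. take i w) ` {1..length w} \<subseteq> C"
  proof clarify
    fix i assume i: "i \<in> {1..length w}"
    have "[] @ take i w @ drop i w \<in> C" using assms(3) by simp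
    moreover have "take i w \<noteq> []" using i by auto
    ultimately show "take i w \<in> C" using assms(1) unfolding factor_closed_def by blast
  qed
  then have "card ((\<lambda>i. take i w) ` {1..length w}) \<le> card C"
    using assms(2) by (rule card_mono[rotated])
  moreover have "inj_on (\<lambda>i. take i w) {1..length w}"
    by (rule inj_on_inverseI[where g = length]) auto
  ultimately show ?thesis by (simp add: card_image)
qed

lemma finite_closed_sets:
  assumes "finite A"
  shows "finite (closed_sets n A)"
proof (rule finite_subset)
  show "closed_sets n A \<subseteq> Pow {w. set w \<subseteq> A \<and> length w \<le> n}"
    using length_le_card by (auto simp: closed_sets_def letters_def)
  show "finite (Pow {w. set w \<subseteq> A \<and> length w \<le> n})"
    using finite_lists_length_le[OF assms] by simp
qed

section \<open>Renaming of letters\<close>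

lemma closed_sets_image:
  assumes inj: "inj_on f A" and C: "C \<in> closed_sets n A"
  shows "map f ` C \<in> closed_sets n (f ` A)"
proof -
  have fc: "factor_closed C" and fin: "finite C" and n: "card C = n" and A: "letters C = A"
    using C by (auto simp: closed_sets_def)
  have "inj_on (map f) C"
    using inj A by (intro inj_on_mapI) (simp add: letters_def)
  moreover have "factor_closed (map f ` C)"
    unfolding factor_closed_def
  proof (intro conjI allI impI)
    show "[] \<notin> map f ` C" using fc by (auto simp: factor_closed_def)
    fix u v w assume "u @ v @ w \<in> map f ` C" and v: "v \<noteq> []"
    then obtain x where "x \<in> C" "map f x = u @ v @ w" by auto
    \<comment> \<open>Cutting \<open>map f x\<close> into three pieces cuts \<open>x\<close> at the
      same positions, so every factor of the image is the image of a factor.\<close>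
    then obtain u' v' w' where "u' @ v' @ w' \<in> C" and v': "v = map f v'"
      by (auto simp: map_eq_append_conv append_eq_map_conv)
    then have "v' \<in> C" using fc v unfolding factor_closed_def by blast
    then show "v \<in> map f ` C" using v' by simp
  qed
  moreover have "letters (map f ` C) = f ` A" using A by (auto simp: letters_def)
  ultimately show ?thesis using fin n by (simp add: closed_sets_def card_image)
qed

lemma closed_sets_image_cancel:
  assumes "C \<in> closed_sets n A" and "\<And>x. x \<in> A \<Longrightarrow> g (f x) = x"
  shows "map g ` map f ` C = C"
proof -
  have "map g (map f w) = w" if "w \<in> C" for w
  proof -
    have "set w \<subseteq> A" using assms(1) that by (auto simp: closed_sets_def letters_def)
    then show ?thesis using assms(2) by (auto intro!: map_idI)
  qed
  then show ?thesis by (force simp: image_image)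
qed

text \<open>Renaming along \<open>f\<close> and along its inverse undo each other on whole families,
  which makes the coefficients depend only on the number of letters.\<close>

lemma card_closed_sets_cong:
  assumes "bij_betw f A B"
  shows "card (closed_sets n A) = card (closed_sets n B)"
proof -
  let ?g = "inv_into A f"
  have f: "inj_on f A" "f ` A = B" using assms by (auto simp: bij_betw_def)
  have g: "inj_on ?g B" "?g ` B = A" using bij_betw_inv_into[OF assms] by (auto simp: bij_betw_def)
  have "bij_betw (image (map f)) (closed_sets n A) (closed_sets n B)"
  proof (rule bij_betw_byWitness[where f' = "image (map ?g)"])
    show "\<forall>C\<in>closed_sets n A. map ?g ` map f ` C = C"
      using closed_sets_image_cancel[of _ n A ?g f] inv_into_f_f[OF f(1)] by simp
    show "\<forall>C\<in>closed_sets n B. map f ` map ?g ` C = C"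
      using closed_sets_image_cancel[of _ n B f ?g] f_inv_into_f[of _ f A] f(2) by simp
    show "image (map f) ` closed_sets n A \<subseteq> closed_sets n B"
      using closed_sets_image[OF f(1)] f(2) by auto
    show "image (map ?g) ` closed_sets n B \<subseteq> closed_sets n A"
      using closed_sets_image[OF g(1)] g(2) by auto
  qed
  then show ?thesis by (rule bij_betw_same_card)
qed

lemma card_closed_sets:
  assumes "finite A"
  shows "card (closed_sets n A) = card (closed_sets n {..<card A})"
proof -
  obtain f where "bij_betw f A {..<card A}"
    using ex_bij_betw_finite_nat[OF assms] by (auto simp: atLeast0LessThan)
  then show ?thesis by (rule card_closed_sets_cong)
qed

lemma closed_sets_empty:
  assumes "n < card A"
  shows "closed_sets n A = {}"
  using assms card_letters_le by (force simp: closed_sets_def)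

lemma closed_sets_no_letters:
  assumes "n \<ge> 1"
  shows "closed_sets n {} = {}"
proof -
  have "C = {}" if "factor_closed C" "letters C = {}" for C :: "'a list set"
    using that by (auto simp: factor_closed_def letters_def)
  then show ?thesis using assms by (force simp: closed_sets_def)
qed

lemma closed_sets_card_eq:
  assumes "finite A"
  shows "closed_sets (card A) A = {(\<lambda>a. [a]) ` A}"
proof (intro equalityI subsetI)
  fix C assume "C \<in> closed_sets (card A) A"
  then have "factor_closed C" "finite C" "card C = card A" "letters C = A"
    by (auto simp: closed_sets_def)
  then have "(\<lambda>a. [a]) ` A = C"
    using factor_closed_singletons_subset[of C] by (intro card_subset_eq) (auto simp: card_letter_words)
  then show "C \<in> {(\<lambda>a. [a]) ` A}" by simp
next
  fix C assume "C \<in> {(\<lambda>a. [a]) ` A}"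
  then have C: "C = (\<lambda>a. [a]) ` A" by simp
  have "factor_closed C"
    unfolding C factor_closed_def by (auto simp: append_eq_Cons_conv)
  moreover have "letters C = A" by (auto simp: C letters_def)
  ultimately show "C \<in> closed_sets (card A) A"
    using assms by (simp add: closed_sets_def C card_letter_words)
qed

section \<open>Ideals as complements of factor-closed sets\<close>

lemma ideal_imp_factor_closed:
  assumes "two_sided_ideal (free_semigroup r) (@) I"
  shows "factor_closed (free_semigroup r - I)"
  unfolding factor_closed_def
proof (intro conjI allI impI)
  show "[] \<notin> free_semigroup r - I" by (simp add: free_semigroup_def)
  fix u v w
  assume uvw: "u @ v @ w \<in> free_semigroup r - I" and v: "v \<noteq> []"
  \<comment> \<open>The outer pieces \<open>u\<close> and \<open>w\<close> may be empty, while
    \<open>[]\<close> is outside the carrier; absorption is therefore first extended to a possibly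
    empty cofactor.\<close>
  have left: "x @ y \<in> I" if "y \<in> I" "set x \<subseteq> {..<r}" for x y
    using that assms by (cases "x = []") (auto simp: two_sided_ideal_def free_semigroup_def)
  have right: "x @ y \<in> I" if "x \<in> I" "set y \<subseteq> {..<r}" for x y
    using that assms by (cases "y = []") (auto simp: two_sided_ideal_def free_semigroup_def)
  have "v \<notin> I" using uvw left right by (auto simp: free_semigroup_def)
  then show "v \<in> free_semigroup r - I" using uvw v by (auto simp: free_semigroup_def)
qed

lemma factor_closed_imp_ideal:
  assumes "factor_closed C"
  shows "two_sided_ideal (free_semigroup r) (@) (free_semigroup r - C)"
proof -
  let ?S = "free_semigroup r"
  \<comment> \<open>This one claim covers closure under products and absorption on both sides: a
    product inside \<open>C\<close> would force both of its factors into \<open>C\<close>.\<close>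
  have "x @ y \<in> ?S - C" if "x \<in> ?S" "y \<in> ?S" "x \<notin> C \<or> y \<notin> C" for x y
  proof -
    have "x \<noteq> []" "y \<noteq> []" "x @ y \<in> ?S" using that by (auto simp: free_semigroup_def)
    moreover have "x @ y \<notin> C"
    proof
      assume "x @ y \<in> C"
      then have "[] @ x @ y \<in> C" "x @ y @ [] \<in> C" by simp_all
      then have "x \<in> C" "y \<in> C"
        using assms \<open>x \<noteq> []\<close> \<open>y \<noteq> []\<close> unfolding factor_closed_def by blast+
      then show False using that by blast
    qed
    ultimately show ?thesis by blast
  qed
  then show ?thesis unfolding two_sided_ideal_def subsemigroup_of_def by blast
qed

lemma bij_betw_ideals_closed_sets:
  "bij_betw (\<lambda>I. free_semigroup r - I) (ideals_of_index (free_semigroup r) (@) n)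
     (\<Union>A\<in>Pow {..<r}. closed_sets n A)"
proof -
  let ?S = "free_semigroup r"
  have sub: "C \<subseteq> ?S" if "C \<in> closed_sets n A" "A \<subseteq> {..<r}" for C A
    using that by (auto simp: closed_sets_def factor_closed_def letters_def free_semigroup_def)
  show ?thesis
  proof (rule bij_betw_byWitness[where f' = "\<lambda>C. ?S - C"])
    show "\<forall>I\<in>ideals_of_index ?S (@) n. ?S - (?S - I) = I"
      by (auto simp: ideals_of_index_def has_rees_index_def)
    show "\<forall>C\<in>\<Union>A\<in>Pow {..<r}. closed_sets n A. ?S - (?S - C) = C"
      using sub by blast
    show "(\<lambda>I. ?S - I) ` ideals_of_index ?S (@) n \<subseteq> (\<Union>A\<in>Pow {..<r}. closed_sets n A)"
    proof clarify
      fix I assume I: "I \<in> ideals_of_index ?S (@) n"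
      have "letters (?S - I) \<subseteq> {..<r}" by (auto simp: letters_def free_semigroup_def)
      moreover have "?S - I \<in> closed_sets n (letters (?S - I))"
        using I ideal_imp_factor_closed
        by (auto simp: ideals_of_index_def has_rees_index_def closed_sets_def)
      ultimately show "?S - I \<in> (\<Union>A\<in>Pow {..<r}. closed_sets n A)" by blast
    qed
    show "(\<lambda>C. ?S - C) ` (\<Union>A\<in>Pow {..<r}. closed_sets n A) \<subseteq> ideals_of_index ?S (@) n"
    proof clarify
      fix C A assume C: "C \<in> closed_sets n A" and A: "A \<subseteq> {..<r}"
      have "?S - (?S - C) = C" using sub[OF C A] by blast
      then show "?S - C \<in> ideals_of_index ?S (@) n"
        using C factor_closed_imp_ideal
        by (auto simp: ideals_of_index_def has_rees_index_def closed_sets_def)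
    qed
  qed
qed

text \<open>Since \<open>card\<close> is 0 on infinite sets, finiteness is what makes
  \<open>num_ideals_FS\<close> a genuine count.\<close>

lemma finite_ideals_of_index: "finite (ideals_of_index (free_semigroup r) (@) n)"
proof -
  have "finite (\<Union>A\<in>Pow {..<r}. closed_sets n A)"
    by (intro finite_UN_I finite_closed_sets) (auto intro: finite_subset)
  then show ?thesis using bij_betw_finite[OF bij_betw_ideals_closed_sets] by blast
qed

lemma sum_Pow_card:
  fixes g :: "nat \<Rightarrow> nat"
  assumes "finite A"
  shows "(\<Sum>B\<in>Pow A. g (card B)) = (\<Sum>k\<le>card A. (card A choose k) * g k)"
proof -
  have "(\<Sum>B\<in>Pow A. g (card B)) = (\<Sum>k\<le>card A. \<Sum>B\<in>{B\<in>Pow A. card B = k}. g (card B))"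
    using assms by (intro sum.group[symmetric]) (auto intro: card_mono)
  also have "\<dots> = (\<Sum>k\<le>card A. (card A choose k) * g k)"
    using n_subsets[OF assms] by (intro sum.cong) auto
  finally show ?thesis .
qed

lemma num_ideals_FS_eq:
  "num_ideals_FS n r = (\<Sum>k\<le>n. (r choose k) * card (closed_sets n {..<k}))"
proof -
  let ?c = "\<lambda>k. card (closed_sets n {..<k::nat})"
  have fin: "finite A" if "A \<in> Pow {..<r}" for A
    using that by (auto intro: finite_subset)
  have "num_ideals_FS n r = card (\<Union>A\<in>Pow {..<r}. closed_sets n A)"
    unfolding num_ideals_FS_def by (rule bij_betw_same_card[OF bij_betw_ideals_closed_sets])
  also have "\<dots> = (\<Sum>A\<in>Pow {..<r}. card (closed_sets n A))"
    \<comment> \<open>Disjointness holds because each \<open>C\<close> determines its index as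
      \<open>letters C\<close>.\<close>
    using fin finite_closed_sets by (intro card_UN_disjoint) (auto simp: closed_sets_def)
  also have "\<dots> = (\<Sum>A\<in>Pow {..<r}. ?c (card A))"
    using fin card_closed_sets by (intro sum.cong) auto
  also have "\<dots> = (\<Sum>k\<le>r. (r choose k) * ?c k)"
    using sum_Pow_card[of "{..<r}" ?c] by simp
  \<comment> \<open>The range passes through \<open>max n r\<close> to cover both orders of
    \<open>n\<close> and \<open>r\<close>: terms with \<open>k > r\<close> vanish by the binomial,
    those with \<open>k > n\<close> because \<open>k\<close> letters need at least \<open>k\<close>
    words.\<close>
  also have "\<dots> = (\<Sum>k\<le>max n r. (r choose k) * ?c k)"
    by (intro sum.mono_neutral_left) (auto simp: binomial_eq_0)
  also have "\<dots> = (\<Sum>k\<le>n. (r choose k) * ?c k)"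
    by (intro sum.mono_neutral_right) (auto simp: closed_sets_empty)
  finally show ?thesis .
qed

text \<open>This is x(x-1)...(x-k+1)/k!, the binomial coefficient as a polynomial in its upper
  argument; characteristic 0 allows the division.\<close>

definition binomial_poly :: "nat \<Rightarrow> 'a :: field_char_0 poly" where
  "binomial_poly k = smult (1 / fact k) (\<Prod>i<k. [:- of_nat i, 1:])"

lemma poly_binomial_poly: "poly (binomial_poly k) x = x gchoose k"
  by (simp add: binomial_poly_def poly_prod gbinomial_prod_rev atLeast0LessThan)

lemma degree_binomial_poly: "degree (binomial_poly k :: 'a :: field_char_0 poly) = k"
  by (simp add: binomial_poly_def degree_prod_eq_sum_degree)

theorem theorem6p9:
  fixes n :: nat
  assumes "n \<ge> 1"
  shows "\<exists>Q :: rat poly. degree Q = n \<and> poly Q 0 = 0 \<and>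
    (\<forall>r\<ge>1. finite (ideals_of_index (free_semigroup r) (@) n) \<and>
            of_nat (num_ideals_FS n r) = poly Q (of_nat r))"
proof -
  define c where "c k = card (closed_sets n {..<k::nat})" for k
  define Q :: "rat poly" where "Q = (\<Sum>k\<le>n. smult (of_nat (c k)) (binomial_poly k))"
  have c0: "c 0 = 0" by (simp add: c_def closed_sets_no_letters[OF assms])
  have cn: "c n = 1" using closed_sets_card_eq[of "{..<n}"] by (simp add: c_def)
  have poly_Q: "poly Q x = (\<Sum>k\<le>n. of_nat (c k) * (x gchoose k))" for x
    by (simp add: Q_def poly_sum poly_binomial_poly)
  \<comment> \<open>The top term is split off with coefficient \<open>c n = 1\<close>. The rest has
    degree below \<open>n\<close>, so nothing cancels it; \<open>n \<ge> 1\<close> matters because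
    an empty sum still has degree 0.\<close>
  have "Q = (\<Sum>k<n. smult (of_nat (c k)) (binomial_poly k)) + binomial_poly n"
    by (simp add: Q_def cn flip: lessThan_Suc_atMost)
  moreover have "degree (\<Sum>k<n. smult (of_nat (c k)) (binomial_poly k :: rat poly)) < n"
    using assms by (intro degree_sum_less) (auto simp: degree_binomial_poly)
  ultimately have "degree Q = n"
    by (simp add: degree_add_eq_right degree_binomial_poly)
  moreover have "poly Q 0 = 0"
    unfolding poly_Q
  proof (intro sum.neutral ballI)
    \<comment> \<open>Only \<open>k = 0\<close> needs \<open>c 0 = 0\<close>, as
      \<open>0 gchoose 0\<close> is 1; for positive \<open>k\<close> the binomial itself
      vanishes.\<close>
    fix k show "of_nat (c k) * ((0 :: rat) gchoose k) = 0"
      using c0 by (cases k) auto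
  qed
  moreover have "of_nat (num_ideals_FS n r) = poly Q (of_nat r)" for r
    by (simp add: poly_Q num_ideals_FS_eq c_def binomial_gbinomial mult.commute)
  ultimately show ?thesis using finite_ideals_of_index by blast
qed

end
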